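(* Let $M_6=\{1,2,3,4,5,6\}$ and let $\mathcal{F}\subset 2^{M_6}$ be a union-closed family of subsets of $M_6$ with $\emptyset\in\mathcal{F}$ and $\bigcup_{A\in\mathcal{F}}A=M_6$. Suppose that $T(\mathcal{F})=3$, i.e. the smallest cardinality of a nonempty set in $\mathcal{F}$ is $3$. Then there exist at least $3$ distinct elements of $M_6$ each of which belongs to at least half of the sets in $\mathcal{F}$, i.e. there are at least $3$ elements $x\in M_6$ with $2\,|\{A\in\mathcal{F}: x\in A\}|\geq |\mathcal{F}|$.
   Context: A family $\mathcal{F}$ of sets is union-closed if $A,B\in\mathcal{F}$ implies $A\cup B\in\mathcal{F}$. For $k=1,\ldots,6$ let $\mathcal{M}_k=\{A\in 2^{M_6}: |A|=k\}$, where $2^{M_6}$ is the set of all subsets of $M_6$, and define $T(\mathcal{F})=\inf\{1\leq k\leq 6: \mathcal{F}\cap\mathcal{M}_k\neq\emptyset\}$. *)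

theory Defs
  imports Main
begin

definition M6 :: "nat set" where
  "M6 = {1..6}"

definition union_closed :: "'a set set \<Rightarrow> bool" where
  "union_closed \<F> \<longleftrightarrow> (\<forall>A\<in>\<F>. \<forall>B\<in>\<F>. A \<union> B \<in> \<F>)"

definition layer :: "nat \<Rightarrow> nat set set" where
  "layer k = {A \<in> Pow M6. card A = k}"

(* On nat, Inf {} = 0 instead of infinity; this value occurs only if the family
   has no nonempty subset of M6 as a member, and it differs from every genuine
   value, since those lie in {1..6}. *)
definition T :: "nat set set \<Rightarrow> nat" where
  "T \<F> = Inf {k \<in> {1..6}. \<F> \<inter> layer k \<noteq> {}}"

end

theory Submission
  imports Defs
begin

text \<open>
  Call an element rare if fewer than half of the members of \<open>\<F>\<close> contain it. If the theorem fails,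
  there is a set \<open>S\<close> of four rare elements; let \<open>Q\<close> consist of the other two. Define the surplus of
  \<open>x\<close> as the number of members containing \<open>x\<close> minus the number of members avoiding \<open>x\<close>. It is at
  most \<open>-1\<close> for each \<open>x\<close> in \<open>S\<close>, so the surpluses over \<open>S\<close> add up to at most \<open>-4\<close>. By double
  counting (\<open>sum_surplus\<close>) this total is the sum over the members \<open>A\<close> of the weight
  \<open>2 * |A \<inter> S| - 4\<close>.

  Since nonempty members have at least three elements, the only ones of negative weight have the
  form \<open>Q \<union> {s}\<close>. Let \<open>K\<close> be the set of the \<open>s\<close> that occur, and \<open>k = |K|\<close>. Closure under unions
  compensates for these sets: it yields the whole cube of the sets \<open>Q \<union> U\<close> with \<open>U \<subseteq> K\<close> nonempty.
  With the corner \<open>U = {}\<close> included, the cube weighs \<open>2 ^ k * (k - 4)\<close> by \<open>sum_Pow_card_weight\<close>,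
  which is \<open>-4, -6, -8, -8, 0\<close> for \<open>k = 0, \<dots>, 4\<close>. That corner, \<open>Q\<close>, is not a member, but \<open>{}\<close>
  is and has the same weight; and the full set adds 4 unless it is already in the cube, which
  happens for \<open>k = 4\<close>. So the total is at least \<open>-4\<close>, and it can only be \<open>-4\<close> if \<open>k\<close> is 2 or 3
  and all remaining members have weight 0.

  In that extremal case choose \<open>y\<close> in \<open>S - K\<close>. If a member other than the full set contained \<open>y\<close>,
  then this member itself or its union with some \<open>Q \<union> {s}\<close> would have positive weight and lie
  outside the cube. Hence only the full set contains \<open>y\<close>, while at least four members avoid it, and
  the total is at most \<open>-3 - 3\<close>, a contradiction.
\<close>

text \<open>On average, a subset of \<open>K\<close> has half as many elements as \<open>K\<close>.\<close>

lemma sum_Pow_card_weight: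
  fixes c :: int
  assumes "finite K"
  shows "(\<Sum>U\<in>Pow K. 2 * int (card U) - c) = 2 ^ card K * (int (card K) - c)"
  using assms
proof (induction K arbitrary: c rule: finite_induct)
  case empty
  then show ?case by simp
next
  case (insert a K)
  have inj: "inj_on (insert a) (Pow K)"
    using insert.hyps by (auto simp: inj_on_def)
  have disj: "Pow K \<inter> insert a ` Pow K = {}"
    using insert.hyps by auto
  have "(\<Sum>U\<in>insert a ` Pow K. 2 * int (card U) - c)
      = (\<Sum>U\<in>Pow K. 2 * int (card (insert a U)) - c)"
    by (simp add: sum.reindex[OF inj])
  also have "\<dots> = (\<Sum>U\<in>Pow K. 2 * int (card U) - (c - 2))"
  proof (rule sum.cong)
    fix U assume "U \<in> Pow K"
    then have "finite U" "a \<notin> U"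
      using insert.hyps by (auto intro: finite_subset)
    then show "2 * int (card (insert a U)) - c = 2 * int (card U) - (c - 2)"
      by simp
  qed simp
  also have "\<dots> = 2 ^ card K * (int (card K) - (c - 2))"
    by (rule insert.IH)
  finally have "(\<Sum>U\<in>Pow (insert a K). 2 * int (card U) - c)
      = 2 ^ card K * (int (card K) - c) + 2 ^ card K * (int (card K) - (c - 2))"
    using insert.hyps by (simp only: Pow_insert sum.union_disjoint disj insert.IH
      finite_imageI finite_Pow_iff)
  then show ?case
    using insert.hyps by (simp add: algebra_simps)
qed

lemma sum_surplus:
  assumes "finite \<F>" "finite S"
  shows "(\<Sum>x\<in>S. 2 * int (card {A \<in> \<F>. x \<in> A}) - int (card \<F>))
       = (\<Sum>A\<in>\<F>. 2 * int (card (A \<inter> S)) - int (card S))"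
proof -
  have "(\<Sum>x\<in>S. card {A \<in> \<F>. x \<in> A}) = (\<Sum>A\<in>\<F>. card {x \<in> S. x \<in> A})"
    using sum_multicount_gen[of S \<F> "\<lambda>x A. x \<in> A" "\<lambda>A. card {x \<in> S. x \<in> A}"] assms by simp
  also have "\<dots> = (\<Sum>A\<in>\<F>. card (A \<inter> S))"
    by (intro sum.cong arg_cong[of _ _ card]) auto
  finally have "(\<Sum>x\<in>S. int (card {A \<in> \<F>. x \<in> A})) = (\<Sum>A\<in>\<F>. int (card (A \<inter> S)))"
    by (metis (mono_tags, lifting) of_nat_sum sum.cong)
  then show ?thesis
    by (simp add: sum_subtractf flip: sum_distrib_left)
qed

lemma union_closed_Union:
  assumes "union_closed \<F>" "finite \<G>" "\<G> \<noteq> {}" "\<G> \<subseteq> \<F>"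
  shows "\<Union>\<G> \<in> \<F>"
  using assms(2-4) by (induction \<G> rule: finite_ne_induct) (use assms(1) in \<open>auto simp: union_closed_def\<close>)

text \<open>
  The weight argument, for an arbitrary split of the ground set into the four elements of \<open>S\<close> and
  the two of \<open>Q\<close>. The total surplus of \<open>S\<close> may be as low as \<open>-4\<close> by the weights alone, which four
  rare elements would just allow; the extremal case is therefore excluded separately.
\<close>

lemma frequent_element_in_four:
  assumes S: "finite S" "card S = 4" and Q: "finite Q" "card Q = 2" and SQ: "S \<inter> Q = {}"
    and sub: "\<F> \<subseteq> Pow (S \<union> Q)" and uc: "union_closed \<F>"
    and empty: "{} \<in> \<F>" and full: "S \<union> Q \<in> \<F>"
    and ge3: "\<And>A. A \<in> \<F> \<Longrightarrow> A \<noteq> {} \<Longrightarrow> card A \<ge> 3"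
  shows "\<exists>x\<in>S. card \<F> \<le> 2 * card {A \<in> \<F>. x \<in> A}"
proof (rule ccontr)
  define w where "w A = 2 * int (card (A \<inter> S)) - 4" for A
  define d where "d x = 2 * int (card {A \<in> \<F>. x \<in> A}) - int (card \<F>)" for x
  define K where "K = {s \<in> S. insert s Q \<in> \<F>}"
  define C where "C = (\<lambda>U. Q \<union> U) ` (Pow K - {{}})"
  define R where "R = \<F> - C - {{}, S \<union> Q}"
  assume "\<not> ?thesis"
  then have d_neg: "d x \<le> -1" if "x \<in> S" for x
    using that by (force simp: d_def)
  have finF: "finite \<F>"
    using sub S Q by (meson finite_Pow_iff finite_UnI finite_subset)
  have K: "K \<subseteq> S" "finite K"
    using S by (auto simp: K_def)
  have k_le: "card K \<le> 4"
    using card_mono[OF S(1) K(1)] S by simp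
  have C_sub: "C \<subseteq> \<F>"
  proof -
    have "Q \<union> U \<in> \<F>" if "U \<subseteq> K" "U \<noteq> {}" for U
    proof -
      have "(\<lambda>s. insert s Q) ` U \<subseteq> \<F>" "finite U"
        using that K by (auto simp: K_def intro: finite_subset)
      then have "\<Union>((\<lambda>s. insert s Q) ` U) \<in> \<F>"
        using union_closed_Union[OF uc] that by blast
      moreover have "\<Union>((\<lambda>s. insert s Q) ` U) = Q \<union> U"
        using that by auto
      ultimately show ?thesis by simp
    qed
    then show ?thesis by (auto simp: C_def)
  qed
  have trace: "(Q \<union> U) \<inter> S = U" if "U \<subseteq> K" for U
    using that K SQ by auto
  have inj: "inj_on (\<lambda>U. Q \<union> U) (Pow K - {{}})"
    by (rule inj_on_inverseI[where g = "\<lambda>A. A \<inter> S"]) (simp add: trace)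
  have Q_ne: "Q \<noteq> {}" using Q by auto
  have full_in_C: "S \<union> Q \<in> C \<longleftrightarrow> card K = 4"
  proof
    assume "S \<union> Q \<in> C"
    then have "S \<subseteq> K" using SQ by (auto simp: C_def)
    with K have "S = K" by blast
    then show "card K = 4" using S by simp
  next
    assume "card K = 4"
    then have "K = S" using card_subset_eq[OF S(1) K(1)] S by simp
    then have "S \<union> Q = Q \<union> K" "K \<in> Pow K - {{}}"
      using \<open>card K = 4\<close> by auto
    then show "S \<union> Q \<in> C" unfolding C_def by (rule image_eqI)
  qed

  \<comment> \<open>the summand 4 compensates for the omitted corner \<open>U = {}\<close>\<close>
  have sumC: "(\<Sum>A\<in>C. w A) = 2 ^ card K * (int (card K) - 4) + 4"
  proof -
    have "(\<Sum>A\<in>C. w A) = (\<Sum>U\<in>Pow K - {{}}. w (Q \<union> U))"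
      by (simp add: C_def sum.reindex[OF inj])
    also have "\<dots> = (\<Sum>U\<in>Pow K - {{}}. 2 * int (card U) - 4)"
      by (rule sum.cong) (simp_all add: w_def trace)
    also have "\<dots> = (\<Sum>U\<in>Pow K. 2 * int (card U) - 4) + 4"
      using K by (simp add: sum_diff)
    finally show ?thesis by (simp add: sum_Pow_card_weight[OF K(2)])
  qed

  \<comment> \<open>at least three elements, at most one of them in \<open>S\<close>, force all of \<open>Q\<close>\<close>
  have small: "\<exists>s\<in>K. A = insert s Q" if A: "A \<in> \<F>" "A \<noteq> {}" and le: "card (A \<inter> S) \<le> 1" for A
  proof -
    have fin: "finite (A \<inter> S)" "finite (A \<inter> Q)" using S Q by auto
    have split: "A = (A \<inter> S) \<union> (A \<inter> Q)" using A sub by auto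
    have "(A \<inter> S) \<inter> (A \<inter> Q) = {}" using SQ by blast
    then have "card A = card (A \<inter> S) + card (A \<inter> Q)"
      using card_Un_disjoint[OF fin] split by simp
    moreover have "card (A \<inter> Q) \<le> 2" using card_mono[of Q "A \<inter> Q"] Q by auto
    ultimately have "card (A \<inter> Q) = 2" "card (A \<inter> S) = 1" using ge3[OF A] le by auto
    then have "A \<inter> Q = Q" "\<exists>s. A \<inter> S = {s}"
      using card_subset_eq[OF Q(1), of "A \<inter> Q"] Q by (auto simp: card_1_singleton_iff)
    then obtain s where "A \<inter> S = {s}" "A = insert s Q" using split by auto
    then show ?thesis using A by (auto simp: K_def)
  qed
  have R_nonneg: "w A \<ge> 0" if A: "A \<in> R" for A
  proof (rule ccontr)
    assume "\<not> ?thesis"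
    then have "card (A \<inter> S) \<le> 1" by (simp add: w_def)
    then obtain s where "s \<in> K" "A = Q \<union> {s}"
      using small[of A] A unfolding R_def by auto
    then have "A \<in> C" by (auto simp: C_def)
    with A show False by (simp add: R_def)
  qed

  have total: "(\<Sum>x\<in>S. d x) = (\<Sum>A\<in>\<F>. w A)"
    using sum_surplus[OF finF S(1)] S by (simp add: d_def w_def)
  have decomp: "(\<Sum>A\<in>\<F>. w A)
      = (\<Sum>A\<in>R. w A) + (\<Sum>A\<in>C. w A) - 4 + (if card K = 4 then 0 else 4)"
  proof -
    have fin: "finite C"
      using finF C_sub by (rule finite_subset[rotated])
    have "C \<union> {{}, S \<union> Q} \<subseteq> \<F>"
      using C_sub empty full by blast
    moreover have "R = \<F> - (C \<union> {{}, S \<union> Q})" by (auto simp: R_def)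
    ultimately have "(\<Sum>A\<in>\<F>. w A) = (\<Sum>A\<in>R. w A) + (\<Sum>A\<in>C \<union> {{}, S \<union> Q}. w A)"
      using finF by (simp only: sum.subset_diff)
    moreover have "{} \<notin> C" "{} \<noteq> S \<union> Q" using Q_ne by (auto simp: C_def)
    moreover have "w {} = -4" "w (S \<union> Q) = 4" using S by (auto simp: w_def Int_absorb1)
    ultimately show ?thesis
      using fin full_in_C by (auto simp: insert_absorb)
  qed
  have R_ge0: "(\<Sum>A\<in>R. w A) \<ge> 0" by (rule sum_nonneg) (rule R_nonneg)
  have k_cases: "card K \<in> {0, 1, 2, 3, 4}" using k_le by auto
  have total_le: "(\<Sum>x\<in>S. d x) \<le> -4"
    using sum_bounded_above[of S d "-1"] d_neg S by simp
  have k: "card K = 2 \<or> card K = 3" and R_le0: "(\<Sum>A\<in>R. w A) \<le> 0"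
    and total_ge: "(\<Sum>x\<in>S. d x) \<ge> -4"
    using total_le R_ge0 k_cases unfolding total decomp sumC by auto

  have "K \<noteq> S" using k S by auto
  then obtain y where y: "y \<in> S" "y \<notin> K" using K by blast
  have only_full: "A = S \<union> Q" if A: "A \<in> \<F>" "y \<in> A" for A
  proof (rule ccontr)
    assume ne: "A \<noteq> S \<union> Q"
    have fin: "finite (A \<inter> S)" using S by simp
    \<comment> \<open>such a \<open>B\<close> has positive weight and, because of \<open>y\<close>, is not in the cube\<close>
    have "\<exists>B\<in>\<F>. y \<in> B \<and> B \<noteq> S \<union> Q \<and> card (B \<inter> S) \<ge> 3"
    proof (cases "card (A \<inter> S) \<ge> 3")
      case True
      then show ?thesis using A ne by auto
    next
      case False
      have "\<not> card (A \<inter> S) \<le> 1"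
        using small[of A] A y SQ by auto
      with False have two: "card (A \<inter> S) = 2" by simp
      have "card (A \<inter> S - {y}) = 1"
        using two A y by simp
      then have "card (K - (A \<inter> S - {y})) \<ge> 1"
        using diff_card_le_card_Diff[of "A \<inter> S - {y}" K] fin k by auto
      then have "K - (A \<inter> S - {y}) \<noteq> {}" by (metis card.empty not_one_le_zero)
      then obtain s where s: "s \<in> K" "s \<notin> A"
        using y K by blast
      let ?B = "A \<union> insert s Q"
      have "?B \<inter> S = insert s (A \<inter> S)"
        using s K SQ by auto
      then have card_B: "card (?B \<inter> S) = 3"
        using two s fin by simp
      then have "?B \<inter> S \<noteq> S" using S by auto
      then have "?B \<noteq> S \<union> Q" by blast
      moreover have "?B \<in> \<F>"
        using uc A s unfolding union_closed_def K_def by blast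
      ultimately show ?thesis using card_B A by (intro bexI[of _ ?B]) auto
    qed
    then obtain B where B: "B \<in> \<F>" "y \<in> B" "B \<noteq> S \<union> Q" "card (B \<inter> S) \<ge> 3" by blast
    then have "B \<in> R"
      using y SQ by (auto simp: R_def C_def)
    then have "w B \<le> (\<Sum>A\<in>R. w A)"
      using R_nonneg finF by (intro member_le_sum) (auto simp: R_def)
    then show False using B R_le0 by (simp add: w_def)
  qed

  \<comment> \<open>members avoiding \<open>y\<close>: the empty set and, as \<open>k \<ge> 2\<close>, at least three sets of the cube\<close>
  have "card C \<ge> 3"
  proof -
    have "card C = 2 ^ card K - 1"
      using K by (simp add: C_def card_image[OF inj] card_Pow)
    then show ?thesis using k by auto
  qed
  moreover have "card (insert {} (insert (S \<union> Q) C)) = card C + 2"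
  proof -
    have "card K \<noteq> 4" using k by auto
    then have "S \<union> Q \<notin> C" by (simp add: full_in_C)
    moreover have "{} \<notin> insert (S \<union> Q) C" using Q_ne by (auto simp: C_def)
    ultimately show ?thesis
      using finite_subset[OF C_sub finF] by simp
  qed
  moreover have "card (insert {} (insert (S \<union> Q) C)) \<le> card \<F>"
    using C_sub empty full finF by (intro card_mono) auto
  ultimately have "card \<F> \<ge> 5" by linarith
  moreover have "{A \<in> \<F>. y \<in> A} = {S \<union> Q}"
    using only_full full y by blast
  ultimately have "d y \<le> -3" by (simp add: d_def)
  moreover have "(\<Sum>x\<in>S - {y}. d x) \<le> -3"
    using sum_bounded_above[of "S - {y}" d "-1"] d_neg S y by simp
  moreover have "(\<Sum>x\<in>S. d x) = d y + (\<Sum>x\<in>S - {y}. d x)"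
    using S y by (simp add: sum.remove)
  ultimately show False using total_ge by linarith
qed

theorem mainTheorem1:
  fixes \<F> :: "nat set set"
  assumes "\<F> \<subseteq> Pow M6"
    and "union_closed \<F>"
    and "{} \<in> \<F>"
    and "\<Union>\<F> = M6"
    and "T \<F> = 3"
  shows "card {x \<in> M6. 2 * card {A \<in> \<F>. x \<in> A} \<ge> card \<F>} \<ge> 3"
proof (rule ccontr)
  let ?G = "{x \<in> M6. 2 * card {A \<in> \<F>. x \<in> A} \<ge> card \<F>}"
  assume "\<not> ?thesis"
  then have few: "card ?G \<le> 2" by simp
  have M6: "finite M6" "card M6 = 6" by (auto simp: M6_def)
  have finF: "finite \<F>" using assms(1) M6 by (meson finite_Pow_iff finite_subset)
  have "card (M6 - ?G) \<ge> 4"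
    using few M6 by (subst card_Diff_subset) auto
  then obtain S where S: "S \<subseteq> M6 - ?G" "card S = 4" "finite S"
    by (rule obtain_subset_with_card_n)
  define Q where "Q = M6 - S"
  have SM: "S \<subseteq> M6" using S by blast
  have Q: "finite Q" "card Q = 2" "S \<inter> Q = {}" "S \<union> Q = M6"
    using S(2,3) SM M6 by (auto simp: Q_def card_Diff_subset)
  have full: "M6 \<in> \<F>"
    using union_closed_Union[OF assms(2) finF] assms(3,4) by auto
  have ge3: "card A \<ge> 3" if A: "A \<in> \<F>" "A \<noteq> {}" for A
  proof -
    have AM: "A \<subseteq> M6" using A assms(1) by blast
    then have "finite A" using M6 by (simp add: finite_subset)
    then have "card A \<in> {1..6}"
      using A card_mono[OF M6(1) AM] M6 by (auto simp: Suc_le_eq card_gt_0_iff)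
    moreover have "\<F> \<inter> layer (card A) \<noteq> {}"
      using A AM by (auto simp: layer_def)
    ultimately have "T \<F> \<le> card A"
      unfolding T_def by (intro cInf_lower) auto
    then show ?thesis using assms(5) by simp
  qed
  have "\<exists>x\<in>S. card \<F> \<le> 2 * card {A \<in> \<F>. x \<in> A}"
    using frequent_element_in_four[of S Q \<F>] S Q assms full ge3 by simp
  then show False using S by blast
qed

end
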